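(* Let $p\ge1$ be an integer. If $F\in\mathcal{HC}_p$ and $a_{k,1}=0$ for all $k\in\{2,\ldots,p\}$, then there exist angles $\alpha,\beta\in\mathbb{R}$ such that $$\mathrm{Re}\left\{\left(e^{i\alpha}\sum_{k=1}^{p}|z|^{2(k-1)}h_k'(z)+e^{-i\alpha}\sum_{k=1}^{p}|z|^{2(k-1)}g_k'(z)\right)\big(e^{i\beta}-e^{-i\beta}z^2\big)\right\}>0$$ for all $z\in\mathbb{D}$.
   Context: $\mathbb{D}=\{z\in\mathbb{C}:|z|<1\}$. For an integer $p\ge1$, $\mathcal{H}_p$ is the set of polyharmonic mappings $F$ in $\mathbb{D}$ of the form $$F(z)=\sum_{k=1}^{p}|z|^{2(k-1)}\big(h_k(z)+\overline{g_k(z)}\big)=\sum_{k=1}^{p}|z|^{2(k-1)}\sum_{j=1}^{\infty}\big(a_{k,j}z^j+\overline{b_{k,j}}\,\overline{z^j}\big),$$ with $h_k(z)=\sum_{j\ge1}a_{k,j}z^j$, $g_k(z)=\sum_{j\ge1}b_{k,j}z^j$ analytic in $\mathbb{D}$, $a_{1,1}=1$, $|b_{1,1}|<1$. In the claim, $h_k,g_k,a_{k,j}$ refer to this representation of $F$. $\mathcal{HC}_p$ is the class of $F\in\mathcal{H}_p$ satisfying $$\sum_{k=1}^{p}\sum_{j=2}^{\infty}\big(2(k-1)+j^2\big)\big(|a_{k,j}|+|b_{k,j}|\big)\le 1-|b_{1,1}|-\sum_{k=2}^{p}(2k-1)\big(|a_{k,1}|+|b_{k,1}|\big)$$ and $$0\le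 |b_{1,1}|+\sum_{k=2}^{p}(2k-1)\big(|a_{k,1}|+|b_{k,1}|\big)<1.$$ *)

theory Defs
  imports "HOL-Complex_Analysis.Complex_Analysis"
begin

text \<open>
  \<open>polyharmonic_rep p F h g a b\<close>: on the unit disc, \<open>F\<close> is the polyharmonic mapping with
  analytic components \<open>h k\<close>, \<open>g k\<close> (\<open>1 \<le> k \<le> p\<close>) and Taylor coefficients \<open>a k j\<close>, \<open>b k j\<close>
  (\<open>j \<ge> 1\<close>; the value at index \<open>0\<close> plays no role, and neither do values off the disc).
\<close>

definition polyharmonic_rep ::
  "nat \<Rightarrow> (complex \<Rightarrow> complex) \<Rightarrow> (nat \<Rightarrow> complex \<Rightarrow> complex) \<Rightarrow> (nat \<Rightarrow> complex \<Rightarrow> complex) \<Rightarrow>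
   (nat \<Rightarrow> nat \<Rightarrow> complex) \<Rightarrow> (nat \<Rightarrow> nat \<Rightarrow> complex) \<Rightarrow> bool" where
  "polyharmonic_rep p F h g a b \<longleftrightarrow>
     (\<forall>k\<in>{1..p}. h k holomorphic_on ball 0 1 \<and> g k holomorphic_on ball 0 1) \<and>
     (\<forall>k\<in>{1..p}. \<forall>z\<in>ball 0 1.
        (\<lambda>j. a k (Suc j) * z ^ Suc j) sums h k z \<and>
        (\<lambda>j. b k (Suc j) * z ^ Suc j) sums g k z) \<and>
     a 1 1 = 1 \<and> cmod (b 1 1) < 1 \<and>
     (\<forall>z\<in>ball 0 1.
        F z = (\<Sum>k=1..p. complex_of_real (cmod z ^ (2 * (k - 1))) * (h k z + cnj (g k z))))"

definition polyharmonic_H :: "nat \<Rightarrow> (complex \<Rightarrow> complex) set" where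
  "polyharmonic_H p = {F. \<exists>h g a b. polyharmonic_rep p F h g a b}"

text \<open>
  Summability is stated explicitly because \<open>suminf\<close> of a divergent series is unspecified.
  In the series over \<open>j \<ge> 2\<close> the index is shifted by \<open>2\<close>.
\<close>

definition HC_condition ::
  "nat \<Rightarrow> (nat \<Rightarrow> nat \<Rightarrow> complex) \<Rightarrow> (nat \<Rightarrow> nat \<Rightarrow> complex) \<Rightarrow> bool" where
  "HC_condition p a b \<longleftrightarrow>
     (\<forall>k\<in>{1..p}. summable (\<lambda>j.
        (2 * (real k - 1) + real (j + 2) ^ 2) * (cmod (a k (j + 2)) + cmod (b k (j + 2))))) \<and>
     (\<Sum>k=1..p. \<Sum>j.
        (2 * (real k - 1) + real (j + 2) ^ 2) * (cmod (a k (j + 2)) + cmod (b k (j + 2))))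
       \<le> 1 - cmod (b 1 1) - (\<Sum>k=2..p. (2 * real k - 1) * (cmod (a k 1) + cmod (b k 1))) \<and>
     0 \<le> cmod (b 1 1) + (\<Sum>k=2..p. (2 * real k - 1) * (cmod (a k 1) + cmod (b k 1))) \<and>
     cmod (b 1 1) + (\<Sum>k=2..p. (2 * real k - 1) * (cmod (a k 1) + cmod (b k 1))) < 1"

text \<open>
  The coefficients with \<open>1 \<le> k \<le> p\<close> and \<open>j \<ge> 1\<close> are determined by the restriction of \<open>F\<close> to the
  disc, so it makes no difference which representation the existential picks.
\<close>

definition polyharmonic_HC :: "nat \<Rightarrow> (complex \<Rightarrow> complex) set" where
  "polyharmonic_HC p =
     {F \<in> polyharmonic_H p. \<exists>h g a b. polyharmonic_rep p F h g a b \<and> HC_condition p a b}"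

end

theory Submission
  imports Defs
begin

text \<open>
  After a rotation \<open>z = cis \<beta> * \<zeta>\<close> the claim concerns
  \<open>\<Psi>(\<zeta>) = m + \<Sum> (n + 1) r^(2 N) C(k, n) \<zeta>^n\<close> with \<open>|m| = 1\<close>, \<open>r = |\<zeta>|\<close>, \<open>N = k - 1\<close>,
  and \<open>\<Sum> ((n + 1)^2 + 2 N) |C(k, n)| \<le> 1\<close>.
  The angles are chosen so that, with \<open>r\<close> replaced by 1 in the weights, the values
  \<open>A = \<Psi>(1)\<close> and \<open>B = \<Psi>(-1)\<close> are real and \<open>A \<ge> 0\<close>. Comparing \<open>\<Psi>\<close> with the interpolant
  \<open>(1 + \<zeta>) A / 2 + (1 - \<zeta>) B / 2\<close>, whose product with \<open>1 - \<zeta>^2\<close> has real part at least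
  \<open>((A + B) / 2 - |A - B|) Re (1 - \<zeta>^2)\<close>, the difference is for each \<open>n\<close> a multiple of
  \<open>r^(2 N) ((\<zeta>^2)^l - 1) - (1 - r^(2 N))\<close> with \<open>l = n div 2\<close>. Since both \<open>|1 - \<zeta>^2|^2\<close> and
  \<open>(1 - r^(2 N)) |1 - \<zeta>^2|\<close> are controlled by \<open>Re (1 - \<zeta>^2)\<close>, every coefficient costs at most
  its weight \<open>(n + 1)^2 + 2 N\<close>, and strictly less if \<open>n > 0\<close>.
\<close>

section \<open>Positivity from coefficient bounds\<close>

lemma norm_square_one_minus:
  fixes z :: complex
  shows "(cmod (1 - z\<^sup>2))\<^sup>2 = 2 * Re (1 - z\<^sup>2) - (1 - (cmod z) ^ 4)"
proof -
  have "(cmod z) ^ 4 = ((Re z)\<^sup>2 + (Im z)\<^sup>2)\<^sup>2"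
    by (simp flip: cmod_power2 power_mult)
  then show ?thesis
    unfolding cmod_power2
    by (simp add: power2_eq_square algebra_simps)
qed

lemma Re_one_minus_square_bounds:
  fixes z :: complex
  shows "1 - (cmod z)\<^sup>2 \<le> Re (1 - z\<^sup>2)" "Re (1 - z\<^sup>2) \<le> 1 + (cmod z)\<^sup>2"
  using complex_Re_le_cmod[of "z\<^sup>2"] abs_Re_le_cmod[of "z\<^sup>2"] by (auto simp: norm_power)

text \<open>In \<open>norm_square_one_minus\<close> the subtracted term factors as
  \<open>(1 - |z|^2) * (1 + |z|^2)\<close>, and its second factor is at least
  \<open>Re (1 - z^2)\<close>.\<close>

lemma norm_square_one_minus_le:
  fixes z :: complex
  assumes "cmod z \<le> 1"
  shows "(cmod (1 - z\<^sup>2))\<^sup>2 \<le> (1 + (cmod z)\<^sup>2) * Re (1 - z\<^sup>2)"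
proof -
  have d: "0 \<le> 1 - (cmod z)\<^sup>2" using assms by (simp add: abs_square_le_1)
  have "(1 - (cmod z)\<^sup>2) * Re (1 - z\<^sup>2) \<le> (1 - (cmod z)\<^sup>2) * (1 + (cmod z)\<^sup>2)"
    by (intro mult_left_mono Re_one_minus_square_bounds d)
  also have "\<dots> = 1 - (cmod z) ^ 4" by (simp add: algebra_simps power2_eq_square numeral_eq_Suc)
  finally show ?thesis unfolding norm_square_one_minus by (simp add: algebra_simps)
qed

text \<open>With \<open>d = 1 - |z|^2\<close> and \<open>x = Re (1 - z^2)\<close>, the right side
  minus the left side is \<open>(x - d)^2 + d^2 * (1 - d)\<close>. This controls the loss from the
  radial weights, which is of order \<open>d\<close>.\<close>

lemma norm_square_one_minus_le_square:
  fixes z :: complex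
  assumes "cmod z \<le> 1"
  shows "(1 - (cmod z)\<^sup>2) * (cmod (1 - z\<^sup>2))\<^sup>2 \<le> (Re (1 - z\<^sup>2))\<^sup>2"
proof -
  define d x where "d = 1 - (cmod z)\<^sup>2" and "x = Re (1 - z\<^sup>2)"
  have d: "0 \<le> d" "d \<le> 1" using assms by (simp_all add: d_def abs_square_le_1)
  have r4: "1 - (cmod z) ^ 4 = d * (2 - d)"
    by (simp add: d_def algebra_simps power2_eq_square numeral_eq_Suc)
  have "x\<^sup>2 - d * (2 * x - d * (2 - d)) = (x - d)\<^sup>2 + d\<^sup>2 * (1 - d)"
    by (simp add: algebra_simps power2_eq_square)
  moreover have "\<dots> \<ge> 0" using d by simp
  ultimately show ?thesis unfolding norm_square_one_minus r4
    unfolding d_def[symmetric] x_def[symmetric] by linarith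
qed

text \<open>Controls the odd part of the interpolant. In the variables \<open>u\<close>,
  \<open>v\<close>, \<open>d\<close> the claim reads
  \<open>u * (d + 4 * v) \<le> (2 - d) * (d + 2 * v)\<close>; the difference splits into
  \<open>2 * v * (2 * (1 - u) - d)\<close> and \<open>d * (2 - u - d)\<close>, both
  nonnegative.\<close>

lemma abs_Re_times_one_minus_square_le:
  fixes z :: complex
  assumes "cmod z \<le> 1"
  shows "\<bar>Re (z * (1 - z\<^sup>2))\<bar> \<le> (1 + (cmod z)\<^sup>2) * Re (1 - z\<^sup>2)"
proof -
  define u v where "u = \<bar>Re z\<bar>" and "v = (Im z)\<^sup>2"
  define d where "d = 1 - u\<^sup>2 - v"
  have r2: "(cmod z)\<^sup>2 = u\<^sup>2 + v" unfolding cmod_power2 u_def v_def by simp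
  have d: "0 \<le> d" "d \<le> 1" using assms r2 abs_square_le_1[of "cmod z"]
    by (simp_all add: d_def u_def v_def)
  have u: "0 \<le> u" "u \<le> 1" using abs_Re_le_cmod[of z] assms by (simp_all add: u_def)
  have v: "0 \<le> v" by (simp add: v_def)
  have dle: "d \<le> 2 * (1 - u)"
  proof -
    have "0 \<le> (1 - u)\<^sup>2" by simp
    then show ?thesis using v by (simp add: d_def power2_eq_square algebra_simps)
  qed
  have x: "Re (1 - z\<^sup>2) = d + 2 * v"
    by (simp add: d_def u_def v_def power2_eq_square)
  have "Re (z * (1 - z\<^sup>2)) = Re z * (1 - (Re z)\<^sup>2 + 3 * (Im z)\<^sup>2)"
    by (simp add: power2_eq_square algebra_simps)
  moreover have "0 \<le> 1 - (Re z)\<^sup>2 + 3 * (Im z)\<^sup>2"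
    using d v unfolding d_def u_def v_def by (simp, linarith)
  ultimately have "\<bar>Re (z * (1 - z\<^sup>2))\<bar> = u * (1 - u\<^sup>2 + 3 * v)"
    by (simp add: abs_mult u_def v_def)
  also have "\<dots> = u * (d + 4 * v)" by (simp add: d_def)
  also have "\<dots> \<le> (2 - d) * (d + 2 * v)"
  proof -
    have "0 \<le> 2 * v * (2 * (1 - u) - d)" using v dle by simp
    moreover have "0 \<le> d * (2 - u - d)" using d u by simp
    ultimately show ?thesis by (simp add: algebra_simps)
  qed
  also have "\<dots> = (1 + (cmod z)\<^sup>2) * Re (1 - z\<^sup>2)" using x r2 by (simp add: d_def)
  finally show ?thesis .
qed

lemma norm_power_minus_one_le:
  fixes w :: complex
  assumes "cmod w \<le> 1"
  shows "cmod (w ^ l - 1) \<le> real l * cmod (1 - w)"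
  using norm_power_diff[of w 1 l] assms by (simp add: norm_minus_commute)

text \<open>
  The next two lemmas compare the cost of the coefficient with index \<open>n = j - 1\<close> (even, then odd)
  with its weight. They are applied with \<open>t = 1 - r^(2 N)\<close>, \<open>\<rho> = (1 + r^2) / 2\<close> and
  \<open>y = t |1 - z^2| / Re (1 - z^2)\<close>.
\<close>

lemma cost_le_odd:
  fixes j N t y \<rho> :: real
  assumes j: "2 \<le> j" and N: "0 \<le> N" and t: "0 \<le> t" and y: "0 \<le> y" "y\<^sup>2 \<le> t * N"
    and \<rho>: "1/2 \<le> \<rho>" "\<rho> \<le> 1"
  shows "j * (1 + \<rho> * (j - 1) * (1 - t) + y) \<le> (1 + \<rho>) / 2 * (j\<^sup>2 + 2 * N)"
proof -
  \<comment> \<open>The factor \<open>1 - t\<close> lowers the cost by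
    \<open>2 * \<rho> * e\<close>. As \<open>j \<le> 2 * (j - 1)\<close>, the AM-GM inequality gives
    \<open>j * y \<le> N + e\<close>; here \<open>e\<close> is absorbed by that gain because
    \<open>\<rho> \<ge> 1/2\<close>, and \<open>N\<close> by the weight.\<close>
  define e where "e = j * (j - 1) * t / 2"
  have e: "0 \<le> e" using j t by (simp add: e_def)
  have "(j * y)\<^sup>2 \<le> j\<^sup>2 * (t * N)" using y by (simp add: power_mult_distrib mult_left_mono)
  also have "\<dots> \<le> (2 * j * (j - 1)) * (t * N)"
    using j t N by (intro mult_right_mono) (auto simp: power2_eq_square)
  also have "\<dots> = 4 * (N * e)" by (simp add: e_def)
  also have "\<dots> \<le> (N + e)\<^sup>2"
    using zero_le_power2[of "N - e"] by (simp add: power2_eq_square algebra_simps)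
  finally have jy: "j * y \<le> N + e" by (rule power2_le_imp_le) (use N e in simp)
  have re: "e \<le> 2 * \<rho> * e" using mult_right_mono[of 1 "2*\<rho>" e] \<rho> e by simp
  have "0 \<le> (1 - \<rho>) * (j * (j - 2) / 2)" using \<rho> j by simp
  moreover have "(1 - \<rho>) * N \<le> N" using \<rho> N by (simp add: algebra_simps)
  moreover have "(1 + \<rho>) / 2 * (j\<^sup>2 + 2 * N) - j * (1 + \<rho> * (j - 1) * (1 - t) + y)
     = (1 - \<rho>) * (j * (j - 2) / 2) + (2 * N - (1 - \<rho>) * N) + 2 * \<rho> * e - j * y"
    by (simp add: e_def algebra_simps add_divide_distrib diff_divide_distrib power2_eq_square)
  ultimately show ?thesis using jy re by linarith
qed

lemma cost_le_even:
  fixes j N t y \<rho> :: real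
  assumes j: "j = 2 \<or> 4 \<le> j" and N: "N = 0 \<or> 1 \<le> N" and t: "0 \<le> t" "t \<le> 1"
    and y: "0 \<le> y" "y\<^sup>2 \<le> t * N"
    and \<rho>: "1/2 \<le> \<rho>" "\<rho> \<le> 1"
  shows "j * (2 * \<rho> + \<rho> * (j - 2) * (1 - t) + y) \<le> (1 + \<rho>) / 2 * (j\<^sup>2 + 2 * N)"
  using j
proof
  assume j: "j = 2"
  \<comment> \<open>For \<open>j = 2\<close> the factor \<open>j - 2\<close> removes any gain from
    \<open>t\<close>, so \<open>y\<close> is estimated directly: it vanishes if
    \<open>N = 0\<close>, and otherwise \<open>2 * y \<le> 1 + y^2\<close>. The extra 1 is recovered
    below from \<open>\<rho> \<le> \<rho> * N\<close>.\<close>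
  have "2 * y \<le> N + (if N = 0 then 0 else 1)"
  proof (cases "N = 0")
    case False
    then have N1: "1 \<le> N" using N by auto
    have "y\<^sup>2 \<le> N" using y(2) t N1 mult_right_mono[of t 1 N] by linarith
    moreover have "0 \<le> (y - 1)\<^sup>2" by simp
    ultimately show ?thesis using False by (simp add: power2_eq_square algebra_simps)
  qed (use y in simp)
  moreover have "2 * \<rho> \<le> 2 - (if N = 0 then 0 else 1) + \<rho> * N"
  proof (cases "N = 0")
    case False
    then have "\<rho> * 1 \<le> \<rho> * N" using \<rho> N by (intro mult_left_mono) auto
    then show ?thesis using \<rho> unfolding if_not_P[OF False] by linarith
  qed (use \<rho> in simp)
  ultimately have "4 * \<rho> + 2 * y \<le> 2 + N + 2 * \<rho> + \<rho> * N"
    by linarith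
  also have "\<dots> = (1 + \<rho>) / 2 * (j\<^sup>2 + 2 * N)"
    by (simp add: j algebra_simps add_divide_distrib)
  finally show ?thesis by (simp add: j)
next
  assume j: "4 \<le> j"
  have N0: "0 \<le> N" using N by auto
  \<comment> \<open>Same AM-GM argument as for odd \<open>j\<close>; it now rests on
    \<open>j \<le> 2 * (j - 2)\<close>, that is, \<open>j \<ge> 4\<close>.\<close>
  define e where "e = j * (j - 2) * t / 2"
  have e: "0 \<le> e" using j t by (simp add: e_def)
  have "(j * y)\<^sup>2 \<le> j\<^sup>2 * (t * N)" using y by (simp add: power_mult_distrib mult_left_mono)
  also have "\<dots> \<le> (2 * j * (j - 2)) * (t * N)"
    using j t N0 by (intro mult_right_mono) (auto simp: power2_eq_square)
  also have "\<dots> = 4 * (N * e)" by (simp add: e_def)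
  also have "\<dots> \<le> (N + e)\<^sup>2"
    using zero_le_power2[of "N - e"] by (simp add: power2_eq_square algebra_simps)
  finally have jy: "j * y \<le> N + e" by (rule power2_le_imp_le) (use N0 e in simp)
  have re: "e \<le> 2 * \<rho> * e" using mult_right_mono[of 1 "2*\<rho>" e] \<rho> e by simp
  have "0 \<le> (1 - \<rho>) * (j\<^sup>2 / 2)" using \<rho> by simp
  moreover have "(1 - \<rho>) * N \<le> N" using \<rho> N0 by (simp add: algebra_simps)
  moreover have "(1 + \<rho>) / 2 * (j\<^sup>2 + 2 * N) - j * (2 * \<rho> + \<rho> * (j - 2) * (1 - t) + y)
     = (1 - \<rho>) * (j\<^sup>2 / 2) + (2 * N - (1 - \<rho>) * N) + 2 * \<rho> * e - j * y"
    by (simp add: e_def algebra_simps add_divide_distrib diff_divide_distrib power2_eq_square)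
  ultimately show ?thesis using jy re by linarith
qed

text \<open>The real part is at least \<open>Re (1 - z^2)\<close> times 1 minus the total cost of
  the coefficients. That cost is below 1: indices \<open>n > 0\<close> cost strictly less than their
  weight, and index 0 alone cannot use up the budget since \<open>\<beta> 0 < 1\<close>.\<close>

lemma positivity_of_coefficients:
  fixes C :: "'k \<Rightarrow> nat \<Rightarrow> complex" and N :: "'k \<Rightarrow> nat" and K :: "'k set" and m z :: complex
  defines "\<beta> \<equiv> \<lambda>n. \<Sum>k\<in>K. (real (Suc n) ^ 2 + 2 * real (N k)) * cmod (C k n)"
    and "c \<equiv> \<lambda>n. of_nat (Suc n) * (\<Sum>k\<in>K. C k n)"
  assumes m: "cmod m = 1"
    and summ: "summable \<beta>" and sum1: "suminf \<beta> \<le> 1" and \<beta>0: "\<beta> 0 < 1"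
    and A: "Im (m + (\<Sum>n. c n)) = 0" "0 \<le> Re (m + (\<Sum>n. c n))"
    and B: "Im (m + (\<Sum>n. (-1) ^ n * c n)) = 0"
    and z: "cmod z < 1"
  shows "0 < Re ((m + (\<Sum>n. of_nat (Suc n) * (\<Sum>k\<in>K. of_real (cmod z ^ (2 * N k)) * C k n) * z ^ n))
                 * (1 - z\<^sup>2))"
proof -
  define r d x \<rho> where "r = cmod z" and "d = 1 - r\<^sup>2" and "x = Re (1 - z\<^sup>2)" and "\<rho> = (1 + r\<^sup>2) / 2"
  define t y where "t = (\<lambda>k. 1 - r ^ (2 * N k))" and "y = (\<lambda>k. t k * cmod (1 - z\<^sup>2) / x)"
  \<comment> \<open>The affine function of \<open>z\<close> that agrees with \<open>z ^ n\<close> at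
    1 and -1.\<close>
  define e where "e = (\<lambda>n::nat. if even n then 1 else z)"
  define q where "q = (\<lambda>n::nat. 2 * real (n div 2))"
  \<comment> \<open>Cost per unit of \<open>cmod (C k n)\<close>, measured in multiples of
    \<open>x\<close>. The summand 1 or \<open>2 * \<rho>\<close> pays for the interpolant, the other
    two for the deviation of the weighted power from \<open>e n\<close>.\<close>
  define cost where "cost = (\<lambda>n k. real (Suc n) *
      ((if even n then 1 else 2 * \<rho>) + \<rho> * q n * (1 - t k) + y k))"
  have r: "0 \<le> r" "r < 1" using z by (auto simp: r_def)
  have r2: "r\<^sup>2 < 1" using r by (simp add: abs_square_less_1)
  have d: "0 < d" "d \<le> 1" using r2 by (auto simp: d_def)
  have x: "d \<le> x" "0 < x" using Re_one_minus_square_bounds(1)[of z] d by (auto simp: d_def x_def r_def)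
  have \<rho>: "1/2 \<le> \<rho>" "\<rho> < 1" using r2 by (auto simp: \<rho>_def)
  have two_\<rho>: "2 * \<rho> = 1 + (cmod z)\<^sup>2" by (simp add: \<rho>_def r_def)
  have t: "0 \<le> t k" "t k \<le> 1" "t k \<le> real (N k) * d" for k
  proof -
    show "0 \<le> t k" "t k \<le> 1" using r by (auto simp: t_def power_le_one)
    have "1 + real (N k) * (r\<^sup>2 - 1) \<le> (1 + (r\<^sup>2 - 1)) ^ N k"
      by (rule Bernoulli_inequality) (use r in auto)
    then show "t k \<le> real (N k) * d" 
      unfolding t_def d_def power_mult[of r 2] by (simp add: algebra_simps)
  qed
  have sq: "(cmod (1 - z\<^sup>2))\<^sup>2 \<le> 2 * \<rho> * x"
    using norm_square_one_minus_le[of z] z unfolding two_\<rho> x_def by simp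
  \<comment> \<open>Only one of the two factors \<open>t k\<close> in the square is replaced by its
    Bernoulli bound \<open>N k * d\<close>; the other is kept, because the AM-GM step in the cost
    estimates needs it.\<close>
  have y: "0 \<le> y k" "(y k)\<^sup>2 \<le> t k * real (N k)" for k
  proof -
    show "0 \<le> y k" using t x by (simp add: y_def)
    have "d * (cmod (1 - z\<^sup>2))\<^sup>2 \<le> x\<^sup>2"
      using norm_square_one_minus_le_square[of z] z by (simp add: d_def x_def r_def)
    then have "t k * (cmod (1 - z\<^sup>2))\<^sup>2 \<le> real (N k) * x\<^sup>2"
      using mult_right_mono[OF t(3), of "(cmod (1 - z\<^sup>2))\<^sup>2" k]
        mult_left_mono[of "d * (cmod (1 - z\<^sup>2))\<^sup>2" "x\<^sup>2" "real (N k)"]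
      by (simp add: mult.assoc)
    from mult_left_mono[OF this t(1)[of k]] show "(y k)\<^sup>2 \<le> t k * real (N k)"
      using x by (simp add: y_def power_mult_distrib power_divide divide_le_eq mult.assoc power2_eq_square mult.left_commute)
  qed

  have cost0: "cost 0 k \<le> 1 + 2 * real (N k)" for k
  proof -
    have "(y k)\<^sup>2 \<le> real (N k) * real (N k)"
    proof (cases "N k = 0")
      case False
      then have "t k * real (N k) \<le> real (N k) * real (N k)"
        using t(2)[of k] by (intro mult_right_mono) auto
      then show ?thesis using y(2)[of k] by linarith
    qed (use y(2)[of k] in simp)
    then have "y k \<le> real (N k)"
      by (intro power2_le_imp_le[of "y k"]) (simp_all add: power2_eq_square)
    then show ?thesis by (simp add: cost_def q_def)
  qed
  have cost_Suc: "cost n k \<le> (1 + \<rho>) / 2 * (real (Suc n) ^ 2 + 2 * real (N k))" if "n \<noteq> 0" for n k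
  proof (cases "even n")
    case True
    then have "q n = real (Suc n) - 1" by (auto simp: q_def elim: evenE)
    then show ?thesis using cost_le_odd[of "real (Suc n)" "real (N k)" "t k" "y k" \<rho>] that y t \<rho> True
      by (simp add: cost_def)
  next
    case False
    then obtain l where l: "n = 2 * l + 1" by (auto elim: oddE)
    then have "q n = real (Suc n) - 2" by (simp add: q_def)
    moreover have "real (Suc n) = 2 \<or> 4 \<le> real (Suc n)" using l by (cases l) auto
    ultimately show ?thesis
      using cost_le_even[of "real (Suc n)" "real (N k)" "t k" "y k" \<rho>] y t \<rho> False
      by (auto simp: cost_def Suc_le_eq)
  qed

  \<comment> \<open>The total cost is below 1\<close>
  define \<gamma> where "\<gamma> = (\<lambda>n. \<Sum>k\<in>K. cost n k * cmod (C k n))"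
  have cost_nonneg: "0 \<le> cost n k" for n k
    using y t \<rho> by (auto simp: cost_def q_def intro!: mult_nonneg_nonneg add_nonneg_nonneg)
  have \<gamma>_nonneg: "0 \<le> \<gamma> n" for n
    unfolding \<gamma>_def by (intro sum_nonneg mult_nonneg_nonneg cost_nonneg) auto
  have \<beta>_nonneg: "0 \<le> \<beta> n" for n
    unfolding \<beta>_def by (intro sum_nonneg) auto
  have \<gamma>0: "\<gamma> 0 \<le> \<beta> 0" unfolding \<gamma>_def \<beta>_def
    by (intro sum_mono mult_right_mono) (use cost0 in auto)
  have \<gamma>S: "\<gamma> (Suc n) \<le> (1 + \<rho>) / 2 * \<beta> (Suc n)" for n
    unfolding \<gamma>_def \<beta>_def sum_distrib_left mult.assoc[symmetric]
    by (intro sum_mono mult_right_mono) (use cost_Suc[of "Suc n"] in auto)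
  have summS: "summable (\<lambda>n. \<beta> (Suc n))" using summ by (simp add: summable_Suc_iff)
  have "summable (\<lambda>n. \<gamma> (Suc n))"
    by (rule summable_comparison_test'[where N = 0, OF summable_mult[OF summS, of "(1 + \<rho>) / 2"]])
      (use \<gamma>S \<gamma>_nonneg in \<open>auto simp: abs_of_nonneg\<close>)
  then have summ\<gamma>: "summable \<gamma>" by (simp add: summable_Suc_iff)
  have sum\<gamma>: "suminf \<gamma> < 1"
  proof -
    have "suminf \<gamma> = \<gamma> 0 + (\<Sum>n. \<gamma> (Suc n))" using suminf_split_head[OF summ\<gamma>] by simp
    also have "\<dots> \<le> \<beta> 0 + (\<Sum>n. (1 + \<rho>) / 2 * \<beta> (Suc n))"
      by (intro add_mono \<gamma>0 suminf_le \<gamma>S summable_mult summS) (use summ\<gamma> in \<open>simp add: summable_Suc_iff\<close>)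
    also have "\<dots> = \<beta> 0 + (1 + \<rho>) / 2 * (suminf \<beta> - \<beta> 0)"
      unfolding suminf_mult[OF summS] suminf_split_head[OF summ] ..
    also have "\<dots> \<le> \<beta> 0 + (1 + \<rho>) / 2 * (1 - \<beta> 0)" using \<rho> sum1 by (intro add_left_mono mult_left_mono) auto
    also have "\<dots> = 1 - (1 - \<rho>) / 2 * (1 - \<beta> 0)" by (simp add: field_simps)
    also have "\<dots> < 1" using \<rho> \<beta>0 by simp
    finally show ?thesis .
  qed

  \<comment> \<open>Interpolant and deviation\<close>
  define D where "D = (\<lambda>n. of_nat (Suc n) * (\<Sum>k\<in>K. C k n * (of_real (r ^ (2 * N k)) * z ^ n - e n)))"
  define \<sigma> where "\<sigma> = (\<lambda>n. real (Suc n) * (\<Sum>k\<in>K. cmod (C k n)))"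
  have c_le: "cmod (c n) \<le> \<sigma> n" for n
    unfolding c_def \<sigma>_def norm_mult norm_of_nat by (intro mult_left_mono norm_sum) auto
  have \<sigma>_nonneg: "0 \<le> \<sigma> n" for n by (simp add: \<sigma>_def sum_nonneg)
  have \<sigma>_le: "\<sigma> n \<le> \<beta> n" for n
  proof -
    have "real (Suc n) \<le> (real (Suc n))\<^sup>2" by (simp add: power2_eq_square)
    then show ?thesis unfolding \<sigma>_def \<beta>_def sum_distrib_left
      by (intro sum_mono mult_right_mono) auto
  qed
  \<comment> \<open>The factor 1/2 makes \<open>suminf \<sigma>\<close> strictly less than 1, which
    decides the sign of \<open>s\<close> below.\<close>
  have \<sigma>S_le: "\<sigma> (Suc n) \<le> 1/2 * \<beta> (Suc n)" for n
  proof -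
    have "2 * real (Suc (Suc n)) \<le> (real (Suc (Suc n)))\<^sup>2"
      unfolding power2_eq_square by (intro mult_right_mono) auto
    then show ?thesis unfolding \<sigma>_def \<beta>_def sum_distrib_left mult.assoc[symmetric]
      by (intro sum_mono mult_right_mono) auto
  qed
  have summ\<sigma>: "summable \<sigma>"
    by (rule summable_comparison_test'[where N = 0, OF summ]) (use \<sigma>_le \<sigma>_nonneg in auto)
  have sum\<sigma>: "suminf \<sigma> < 1"
  proof -
    have "suminf \<sigma> = \<sigma> 0 + (\<Sum>n. \<sigma> (Suc n))" using suminf_split_head[OF summ\<sigma>] by simp
    also have "\<dots> \<le> \<beta> 0 + (\<Sum>n. 1/2 * \<beta> (Suc n))"
      by (intro add_mono \<sigma>_le suminf_le \<sigma>S_le summable_mult summS) (use summ\<sigma> in \<open>simp add: summable_Suc_iff\<close>)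
    also have "\<dots> = \<beta> 0 + 1/2 * (suminf \<beta> - \<beta> 0)"
      unfolding suminf_mult[OF summS] suminf_split_head[OF summ] ..
    also have "\<dots> < 1" using add_le_less_mono[OF sum1 \<beta>0] by (simp add: field_simps)
    finally show ?thesis .
  qed
  have summ_bounded: "summable f" if "\<And>n. cmod (f n) \<le> \<sigma> n" for f
    by (rule summable_comparison_test'[where N = 0, OF summ\<sigma>]) (use that in auto)
  define \<sigma>e \<sigma>o where "\<sigma>e = (\<lambda>n. if even n then \<sigma> n else 0)" and "\<sigma>o = (\<lambda>n. if even n then 0 else \<sigma> n)"
  define ce co where "ce = (\<lambda>n. if even n then c n else 0)" and "co = (\<lambda>n. if even n then 0 else c n)"
  have summ_eo: "summable \<sigma>e" "summable \<sigma>o"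
    by (rule summable_comparison_test'[where N = 0, OF summ\<sigma>];
        use \<sigma>_nonneg in \<open>auto simp: \<sigma>e_def \<sigma>o_def\<close>)+
  have summ_c: "summable ce" "summable co" "summable c" "summable (\<lambda>n. (-1) ^ n * c n)"
    by (rule summ_bounded; use c_le \<sigma>_nonneg in \<open>auto simp: ce_def co_def norm_mult norm_power\<close>)+
  have sum_eo: "suminf \<sigma>e + suminf \<sigma>o = suminf \<sigma>"
    unfolding suminf_add[OF summ_eo] by (rule suminf_cong) (simp add: \<sigma>e_def \<sigma>o_def)
  have sum_c: "suminf c = suminf ce + suminf co"
    unfolding suminf_add[OF summ_c(1,2)] by (rule suminf_cong) (simp add: ce_def co_def)
  have sum_c': "(\<Sum>n. (-1) ^ n * c n) = suminf ce - suminf co"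
    unfolding suminf_diff[OF summ_c(1,2)] by (rule suminf_cong) (simp add: ce_def co_def)
  \<comment> \<open>Half the sum and half the difference of the values at 1 and -1, so both numbers
    are real; the interpolant is \<open>s + \<delta> * z\<close>.\<close>
  define s \<delta> where "s = Re (m + suminf ce)" and "\<delta> = Re (suminf co)"
  have s: "m + suminf ce = of_real s" and \<delta>: "suminf co = of_real \<delta>"
    using A(1) B unfolding sum_c sum_c' by (auto simp: complex_eq_iff s_def \<delta>_def)
  have ce_le: "cmod (suminf ce) \<le> suminf \<sigma>e"
    by (rule norm_suminf_le[OF _ summ_eo(1)]) (use c_le \<sigma>_nonneg in \<open>auto simp: ce_def \<sigma>e_def\<close>)
  have \<delta>_le: "\<bar>\<delta>\<bar> \<le> suminf \<sigma>o"
  proof -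
    have "cmod (suminf co) \<le> suminf \<sigma>o"
      by (rule norm_suminf_le[OF _ summ_eo(2)]) (use c_le \<sigma>_nonneg in \<open>auto simp: co_def \<sigma>o_def\<close>)
    then show ?thesis by (simp add: \<delta>)
  qed
  \<comment> \<open>The triangle inequality bounds only \<open>|s|\<close>. A negative
    \<open>s\<close> is excluded: \<open>s + \<delta> \<ge> 0\<close> would force
    \<open>1 - suminf \<sigma>e \<le> suminf \<sigma>o\<close>, against
    \<open>suminf \<sigma> < 1\<close>.\<close>
  have s_ge: "1 - suminf \<sigma>e \<le> s"
  proof -
    have "1 \<le> cmod (m + suminf ce) + cmod (suminf ce)"
      using norm_triangle_ineq4[of "m + suminf ce" "suminf ce"] m by simp
    then have "1 - suminf \<sigma>e \<le> \<bar>s\<bar>" using ce_le by (simp add: s)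
    moreover have "0 \<le> s + \<delta>" using A(2) by (simp add: sum_c s_def \<delta>_def)
    ultimately show ?thesis using \<delta>_le sum_eo sum\<sigma> by linarith
  qed

  \<comment> \<open>The subtracted amount is the share of the cost reserved for the
    interpolant.\<close>
  have D_le: "cmod (D n * (1 - z\<^sup>2)) \<le> x * (\<gamma> n - (\<sigma>e n + 2 * \<rho> * \<sigma>o n))" for n
  proof -
    have e1: "cmod (e n) \<le> 1" using z by (auto simp: e_def)
    have zn: "z ^ n = e n * (z\<^sup>2) ^ (n div 2)"
      by (cases "even n") (auto simp: e_def power_mult[symmetric] elim!: evenE oddE)
    have "cmod (z ^ n - e n) \<le> cmod ((z\<^sup>2) ^ (n div 2) - 1)"
      using mult_right_mono[OF e1, of "cmod ((z\<^sup>2) ^ (n div 2) - 1)"]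
      by (simp add: zn norm_mult[symmetric] algebra_simps)
    also have "\<dots> \<le> real (n div 2) * cmod (1 - z\<^sup>2)"
      by (rule norm_power_minus_one_le) (use r2 in \<open>simp add: norm_power r_def\<close>)
    finally have zne: "cmod (z ^ n - e n) \<le> real (n div 2) * cmod (1 - z\<^sup>2)" .
    have term_le: "cmod ((of_real (r ^ (2 * N k)) * z ^ n - e n) * (1 - z\<^sup>2))
        \<le> x * (\<rho> * q n * (1 - t k) + y k)" for k
    proof -
      \<comment> \<open>The first part carries a second factor \<open>1 - z^2\<close>, so
        \<open>sq\<close> applies; the second has norm at most
        \<open>t k * cmod (1 - z^2) = x * y k\<close>.\<close>
      have "(of_real (r ^ (2 * N k)) * z ^ n - e n) * (1 - z\<^sup>2)
          = of_real (1 - t k) * ((z ^ n - e n) * (1 - z\<^sup>2)) - of_real (t k) * (e n * (1 - z\<^sup>2))"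
        by (simp add: t_def algebra_simps)
      also have "cmod \<dots> \<le> (1 - t k) * (cmod (z ^ n - e n) * cmod (1 - z\<^sup>2)) + t k * (cmod (e n) * cmod (1 - z\<^sup>2))"
        using t[of k] by (intro order_trans[OF norm_triangle_ineq4]) (simp add: norm_mult del: of_real_diff)
      also have "\<dots> \<le> (1 - t k) * (real (n div 2) * cmod (1 - z\<^sup>2) * cmod (1 - z\<^sup>2)) + t k * (1 * cmod (1 - z\<^sup>2))"
        using t[of k] by (intro add_mono mult_left_mono mult_right_mono zne e1) auto
      also have "\<dots> = (1 - t k) * real (n div 2) * (cmod (1 - z\<^sup>2))\<^sup>2 + x * y k"
        using x by (simp add: y_def power2_eq_square)
      also have "\<dots> \<le> (1 - t k) * real (n div 2) * (2 * \<rho> * x) + x * y k"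
        using t[of k] by (intro add_right_mono mult_left_mono sq) auto
      finally show ?thesis by (simp add: q_def algebra_simps)
    qed
    have "cmod (D n * (1 - z\<^sup>2)) = real (Suc n) *
        cmod (\<Sum>k\<in>K. C k n * ((of_real (r ^ (2 * N k)) * z ^ n - e n) * (1 - z\<^sup>2)))"
      by (simp add: D_def norm_mult[symmetric] sum_distrib_right mult.assoc del: of_nat_Suc)
        (simp add: norm_mult sum_distrib_right mult.assoc del: of_nat_Suc)
    also have "\<dots> \<le> real (Suc n) * (\<Sum>k\<in>K. cmod (C k n) * (x * (\<rho> * q n * (1 - t k) + y k)))"
      by (intro mult_left_mono sum_norm_le) (use term_le in \<open>auto simp only: norm_mult[of "C _ _"] intro!: mult_left_mono\<close>, auto)
    also have "\<dots> = x * (\<gamma> n - (\<sigma>e n + 2 * \<rho> * \<sigma>o n))"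
      by (simp add: \<gamma>_def \<sigma>e_def \<sigma>o_def \<sigma>_def cost_def sum_distrib_left sum_subtractf[symmetric] del: of_nat_Suc)
        (auto intro!: sum.cong simp: algebra_simps simp del: of_nat_Suc)
    finally show ?thesis .
  qed
  have summR: "summable (\<lambda>n. x * (\<gamma> n - (\<sigma>e n + 2 * \<rho> * \<sigma>o n)))"
    by (intro summable_mult summable_diff summable_add summ\<gamma> summ_eo)
  have summDz: "summable (\<lambda>n. D n * (1 - z\<^sup>2))"
    by (rule summable_comparison_test'[where N = 0, OF summR]) (use D_le in auto)
  have z2: "1 - z\<^sup>2 \<noteq> 0" using x by (auto simp: x_def)
  have summD: "summable D" using summable_mult2[OF summDz, of "inverse (1 - z\<^sup>2)"] z2 by (simp only: mult.assoc right_inverse mult_1_right not_False_eq_True simp_thms)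
  have D_sum_le: "cmod (suminf D * (1 - z\<^sup>2)) \<le> x * (suminf \<gamma> - (suminf \<sigma>e + 2 * \<rho> * suminf \<sigma>o))"
  proof -
    have "suminf D * (1 - z\<^sup>2) = (\<Sum>n. D n * (1 - z\<^sup>2))" by (rule suminf_mult2[OF summD])
    also have "cmod \<dots> \<le> (\<Sum>n. x * (\<gamma> n - (\<sigma>e n + 2 * \<rho> * \<sigma>o n)))"
      by (rule norm_suminf_le[OF D_le summR])
    also have "\<dots> = x * (suminf \<gamma> - (suminf \<sigma>e + 2 * \<rho> * suminf \<sigma>o))"
      by (intro sums_unique[symmetric] sums_mult sums_diff sums_add summable_sums summ\<gamma> summ_eo)
    finally show ?thesis .
  qed
  have "(\<Sum>n. of_nat (Suc n) * (\<Sum>k\<in>K. of_real (cmod z ^ (2 * N k)) * C k n) * z ^ n)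
      = (\<Sum>n. ce n + z * co n + D n)"
    by (rule suminf_cong)
      (auto simp: ce_def co_def c_def D_def e_def r_def sum_distrib_left sum_distrib_right
        sum.distrib[symmetric] sum_subtractf algebra_simps simp del: of_nat_Suc)
  also have "\<dots> = suminf ce + z * suminf co + suminf D"
    by (intro sums_unique[symmetric] sums_mult sums_add summable_sums summ_c summD)
  finally have eq: "(m + (\<Sum>n. of_nat (Suc n) * (\<Sum>k\<in>K. of_real (cmod z ^ (2 * N k)) * C k n) * z ^ n)) * (1 - z\<^sup>2)
      = of_real s * (1 - z\<^sup>2) + of_real \<delta> * (z * (1 - z\<^sup>2)) + suminf D * (1 - z\<^sup>2)"
    by (simp add: s[symmetric] \<delta>[symmetric] algebra_simps)
  have "\<bar>Re (z * (1 - z\<^sup>2))\<bar> \<le> 2 * \<rho> * x"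
    using abs_Re_times_one_minus_square_le[of z] z unfolding two_\<rho> x_def by simp
  then have \<delta>_term: "\<bar>\<delta> * Re (z * (1 - z\<^sup>2))\<bar> \<le> suminf \<sigma>o * (2 * \<rho> * x)"
    unfolding abs_mult using \<delta>_le by (intro mult_mono) auto
  have s_term: "x - suminf \<sigma>e * x \<le> s * x"
    using mult_right_mono[OF s_ge, of x] x by (simp add: algebra_simps)
  have "\<bar>Re (suminf D * (1 - z\<^sup>2))\<bar> \<le> x * (suminf \<gamma> - (suminf \<sigma>e + 2 * \<rho> * suminf \<sigma>o))"
    using abs_Re_le_cmod D_sum_le by (rule order_trans)
  also have "\<dots> = x * suminf \<gamma> - suminf \<sigma>e * x - suminf \<sigma>o * (2 * \<rho> * x)"
    by (simp add: algebra_simps)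
  finally have D_term: "\<bar>Re (suminf D * (1 - z\<^sup>2))\<bar> \<le> \<dots>" .
  \<comment> \<open>The shares of \<open>\<sigma>e\<close> and \<open>\<sigma>o\<close> cancel
    between interpolant and deviation, leaving \<open>x - x * suminf \<gamma>\<close>.\<close>
  have "u - v \<le> p' + a' + b'" if "\<bar>a'\<bar> \<le> c'" "u - e' \<le> p'" "\<bar>b'\<bar> \<le> v - e' - c'"
    for u v p' a' b' c' e' :: real
    using that by linarith
  from this[OF \<delta>_term s_term D_term]
  have "x * (1 - suminf \<gamma>) \<le> s * x + \<delta> * Re (z * (1 - z\<^sup>2)) + Re (suminf D * (1 - z\<^sup>2))"
    by (simp only: right_diff_distrib mult_1_right)
  moreover have "0 < x * (1 - suminf \<gamma>)" using x sum\<gamma> by simp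
  ultimately show ?thesis
    unfolding eq plus_complex.sel Re_complex_of_real times_complex.sel(1)[of "of_real _"] x_def[symmetric]
    by simp
qed

section \<open>Uniqueness of the polyharmonic representation\<close>

text \<open>The maximum principle for \<open>f\<close> and \<open>-f\<close> makes the real part
  vanish inside the circle. The image then lies in the imaginary axis and is not open, so
  \<open>f\<close> is constant there.\<close>

lemma holomorphic_zero_if_Re_zero_on_sphere:
  fixes f :: "complex \<Rightarrow> complex"
  assumes f: "f holomorphic_on ball 0 1" and r: "0 < r" "r < 1"
    and Re0: "\<And>z. cmod z = r \<Longrightarrow> Re (f z) = 0" and f0: "f 0 = 0" and z: "cmod z < r"
  shows "f z = 0"
proof -
  have sub: "cball 0 r \<subseteq> ball (0 :: complex) 1" using r by auto
  have le: "Re (g w) \<le> 0"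
    if g: "g holomorphic_on ball 0 1" "\<And>z. cmod z = r \<Longrightarrow> Re (g z) = 0" and w: "cmod w < r"
    for g :: "complex \<Rightarrow> complex" and w
  proof (rule maximum_real_frontier[of g "cball 0 r"])
    show "g holomorphic_on interior (cball 0 r)"
      using g(1) by (rule holomorphic_on_subset) (use r in auto)
    show "continuous_on (closure (cball 0 r)) g"
      using holomorphic_on_imp_continuous_on[OF g(1)] sub by (auto intro: continuous_on_subset)
  qed (use g r w in auto)
  have Re_f: "Re (f w) = 0" if "cmod w < r" for w
    using le[OF f Re0 that] le[of "\<lambda>z. - f z" w] f Re0 that by (auto intro: holomorphic_intros antisym)
  have "f constant_on ball 0 r"
  proof (rule ccontr)
    assume "\<not> f constant_on ball 0 r"
    then have "open (f ` ball 0 r)"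
      using r by (intro open_mapping_thm[of f "ball 0 r"] holomorphic_on_subset[OF f]) auto
    moreover have "0 \<in> f ` ball 0 r" using f0 r by (auto intro!: image_eqI[of _ _ 0])
    ultimately obtain e where e: "0 < e" "ball 0 e \<subseteq> f ` ball 0 r" by (auto simp: open_contains_ball)
    then have "complex_of_real (e / 2) \<in> f ` ball 0 r" by (intro subsetD[OF e(2)]) auto
    then obtain w where w: "cmod w < r" "f w = complex_of_real (e / 2)" by auto
    show False using Re_f[OF w(1)] e(1) unfolding w(2) by simp
  qed
  then show ?thesis using f0 z r by (auto simp: constant_on_def)
qed

text \<open>On the circle the equation says that \<open>H + G\<close> and
  \<open>\<i> * (H - G)\<close> have real part zero.\<close>

lemma holomorphic_add_cnj_zero_on_sphere:
  fixes H G :: "complex \<Rightarrow> complex"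
  assumes "H holomorphic_on ball 0 1" "G holomorphic_on ball 0 1" and r: "0 < r" "r < 1"
    and eq: "\<And>z. cmod z = r \<Longrightarrow> H z + cnj (G z) = 0" and "H 0 = 0" "G 0 = 0" and z: "cmod z < r"
  shows "H z = 0" "G z = 0"
proof -
  have "H z + G z = 0"
    by (rule holomorphic_zero_if_Re_zero_on_sphere[where r = r])
      (use assms eq in \<open>auto intro!: holomorphic_intros simp: complex_eq_iff\<close>)
  moreover have "\<i> * (H z - G z) = 0"
    by (rule holomorphic_zero_if_Re_zero_on_sphere[where r = r])
      (use assms eq in \<open>auto intro!: holomorphic_intros simp: complex_eq_iff\<close>)
  ultimately show "H z = 0" "G z = 0" by (auto simp: eq_neg_iff_add_eq_0[symmetric])
qed

text \<open>The zeros of a nontrivial power series are isolated. The series starts at exponent 1, so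
  \<open>a\<close> prepends a zero constant term.\<close>

lemma power_series_zero_imp_coeff_zero:
  fixes c :: "nat \<Rightarrow> complex"
  assumes r: "0 < r" and sums: "\<And>z. cmod z < r \<Longrightarrow> (\<lambda>j. c j * z ^ Suc j) sums 0"
  shows "c j = 0"
proof (rule ccontr)
  assume c: "c j \<noteq> 0"
  define a where "a = (\<lambda>n. if n = 0 then 0 else c (n - 1))"
  have "(\<lambda>n. a n * (z - 0) ^ n) sums 0" if "cmod (z - 0) < r" for z
    using sums[of z] that sums_Suc_iff[of "\<lambda>n. a n * (z - 0) ^ n" 0] by (simp add: a_def)
  then obtain s where s: "0 < s" "\<And>z :: complex. z \<in> cball 0 s - {0} \<Longrightarrow> (0 :: complex) \<noteq> 0"
    using c by (elim powser_0_nonzero[OF r, of 0 a "\<lambda>_. 0" "Suc j"]) (auto simp: a_def)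
  have "complex_of_real s \<in> cball 0 s - {0}" using s(1) by auto
  then show False using s(2) by blast
qed

text \<open>The sum is a polynomial in \<open>r^2\<close> with infinitely many roots.\<close>

lemma even_polynomial_zero_imp_coeff_zero:
  fixes D :: "nat \<Rightarrow> complex"
  assumes zero: "\<And>r :: real. 0 < r \<Longrightarrow> r < 1 \<Longrightarrow> (\<Sum>k=1..p. of_real (r ^ (2 * (k - 1))) * D k) = 0"
    and k: "k \<in> {1..p}"
  shows "D k = 0"
proof (rule ccontr)
  assume D: "D k \<noteq> 0"
  define P where "P = {x. (\<Sum>i\<le>p - 1. D (Suc i) * x ^ i) = 0}"
  have "finite P" unfolding P_def
    by (rule iffD2[OF polyfun_finite_roots]) (use k D in \<open>auto intro!: exI[of _ "k - 1"]\<close>)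
  moreover have "(\<lambda>r. complex_of_real (r\<^sup>2)) ` {0<..<1} \<subseteq> P"
  proof safe
    fix r :: real assume r: "r \<in> {0<..<1}"
    have "(\<Sum>k=1..p. of_real (r ^ (2 * (k - 1))) * D k) = (\<Sum>i\<le>p - 1. D (Suc i) * of_real (r\<^sup>2) ^ i)"
    proof (rule sum.reindex_bij_witness[of _ Suc "\<lambda>k. k - 1"])
      fix i assume "i \<in> {1..p}"
      then have "Suc (i - 1) = i" by auto
      then show "D (Suc (i - 1)) * of_real (r\<^sup>2) ^ (i - 1) = of_real (r ^ (2 * (i - 1))) * D i"
        unfolding power_mult[of r 2] of_real_power[symmetric] by (simp only: mult.commute)
    qed (use k in auto)
    then show "complex_of_real (r\<^sup>2) \<in> P" using zero[OF _ , of r] r unfolding P_def by simp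
  qed
  moreover have "infinite ((\<lambda>r. complex_of_real (r\<^sup>2)) ` {0<..<1})"
    by (subst finite_image_iff) (auto intro!: inj_onI simp del: of_real_power)
  ultimately show False using finite_subset by blast
qed

lemma polyharmonic_rep_component_zero:
  assumes "polyharmonic_rep p F h g a b" and k: "k \<in> {1..p}"
  shows "h k 0 = 0" "g k 0 = 0"
proof -
  have "(\<lambda>j. a k (Suc j) * 0 ^ Suc j) sums h k 0" "(\<lambda>j. b k (Suc j) * 0 ^ Suc j) sums g k 0"
    using assms unfolding polyharmonic_rep_def by (meson centre_in_ball zero_less_one)+
  then show "h k 0 = 0" "g k 0 = 0" using sums_unique2[OF _ sums_zero] by auto
qed

lemma polyharmonic_rep_eq:
  assumes "polyharmonic_rep p F h g a b" and "z \<in> ball 0 1"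
  shows "F z = (\<Sum>k=1..p. complex_of_real (cmod z ^ (2 * (k - 1))) * (h k z + cnj (g k z)))"
  using assms unfolding polyharmonic_rep_def by blast

text \<open>On a circle of fixed radius \<open>r\<close> the weights
  \<open>|z|^(2 * (k - 1))\<close> are constants, so the difference of the representations is
  \<open>H + cnj G\<close> with \<open>H\<close>, \<open>G\<close> holomorphic, and both vanish
  inside. Comparing Taylor coefficients gives a polynomial identity in \<open>r^2\<close>; varying
  \<open>r\<close> separates the components.\<close>

lemma polyharmonic_rep_unique:
  assumes rep: "polyharmonic_rep p F h g a b" and rep': "polyharmonic_rep p F h' g' a' b'"
    and k: "k \<in> {1..p}"
  shows "a k (Suc j) = a' k (Suc j)" "b k (Suc j) = b' k (Suc j)"
proof -
  have radial: "(\<Sum>k=1..p. of_real (r ^ (2 * (k - 1))) * (a k (Suc j) - a' k (Suc j))) = 0 \<and>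
      (\<Sum>k=1..p. of_real (r ^ (2 * (k - 1))) * (b k (Suc j) - b' k (Suc j))) = 0"
    if r: "0 < r" "r < 1" for r :: real and j
  proof -
    define w where "w = (\<lambda>k. complex_of_real (r ^ (2 * (k - 1))))"
    define H where "H = (\<lambda>z. \<Sum>k=1..p. w k * (h k z - h' k z))"
    define G where "G = (\<lambda>z. \<Sum>k=1..p. w k * (g k z - g' k z))"
    have cnj_w: "cnj (w k) = w k" for k by (simp add: w_def)
    have hol: "H holomorphic_on ball 0 1" "G holomorphic_on ball 0 1"
      unfolding H_def G_def using rep rep'
      by (auto simp: polyharmonic_rep_def intro!: holomorphic_intros)
    have zero: "H 0 = 0" "G 0 = 0"
      unfolding H_def G_def
      using polyharmonic_rep_component_zero[OF rep] polyharmonic_rep_component_zero[OF rep']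
      by (auto intro!: sum.neutral)
    have eq: "H z + cnj (G z) = 0" if z: "cmod z = r" for z
    proof -
      have ball: "z \<in> ball 0 1" using z r by simp
      have "H z + cnj (G z) = (\<Sum>k=1..p. w k * (h k z + cnj (g k z))) - (\<Sum>k=1..p. w k * (h' k z + cnj (g' k z)))"
        unfolding H_def G_def cnj_sum sum.distrib[symmetric] sum_subtractf[symmetric]
        by (rule sum.cong) (simp_all add: cnj_w algebra_simps)
      also have "(\<Sum>k=1..p. w k * (h k z + cnj (g k z))) = F z"
        unfolding w_def z[symmetric] by (rule polyharmonic_rep_eq[OF rep ball, symmetric])
      also have "(\<Sum>k=1..p. w k * (h' k z + cnj (g' k z))) = F z"
        unfolding w_def z[symmetric] by (rule polyharmonic_rep_eq[OF rep' ball, symmetric])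
      finally show ?thesis by simp
    qed
    have ser': "(\<lambda>j. (\<Sum>k=1..p. w k * (a k (Suc j) - a' k (Suc j))) * z ^ Suc j) sums H z \<and>
        (\<lambda>j. (\<Sum>k=1..p. w k * (b k (Suc j) - b' k (Suc j))) * z ^ Suc j) sums G z"
      if "cmod z < r" for z
      unfolding H_def G_def sum_distrib_right mult.assoc left_diff_distrib
      using rep rep' that r
      by (intro conjI sums_sum sums_mult sums_diff) (auto simp: polyharmonic_rep_def)
    have ser: "(\<lambda>j. (\<Sum>k=1..p. w k * (a k (Suc j) - a' k (Suc j))) * z ^ Suc j) sums 0"
        "(\<lambda>j. (\<Sum>k=1..p. w k * (b k (Suc j) - b' k (Suc j))) * z ^ Suc j) sums 0"
      if "cmod z < r" for z
    proof -
      have "H z = 0" "G z = 0"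
        by (rule holomorphic_add_cnj_zero_on_sphere[OF hol r eq zero that]; assumption)+
      with ser'[OF that] show "(\<lambda>j. (\<Sum>k=1..p. w k * (a k (Suc j) - a' k (Suc j))) * z ^ Suc j) sums 0"
        "(\<lambda>j. (\<Sum>k=1..p. w k * (b k (Suc j) - b' k (Suc j))) * z ^ Suc j) sums 0"
        by (simp_all only:)
    qed
    show ?thesis
      using power_series_zero_imp_coeff_zero[OF r(1) ser(1)]
        power_series_zero_imp_coeff_zero[OF r(1) ser(2)] by (simp add: w_def)
  qed
  show "a k (Suc j) = a' k (Suc j)"
    using even_polynomial_zero_imp_coeff_zero[where p = p and D = "\<lambda>k. a k (Suc j) - a' k (Suc j)" and k = k] radial k by simp
  show "b k (Suc j) = b' k (Suc j)"
    using even_polynomial_zero_imp_coeff_zero[where p = p and D = "\<lambda>k. b k (Suc j) - b' k (Suc j)" and k = k] radial k by simp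
qed

text \<open>Membership provides the inequality for some representation only; uniqueness of the
  coefficients transfers it to the given one.\<close>

lemma HC_condition_of_polyharmonic_HC:
  assumes F: "F \<in> polyharmonic_HC p" and rep: "polyharmonic_rep p F h g a b" and p: "1 \<le> p"
  shows "HC_condition p a b"
proof -
  obtain h' g' a' b' where rep': "polyharmonic_rep p F h' g' a' b'" and HC: "HC_condition p a' b'"
    using F unfolding polyharmonic_HC_def by blast
  have eq: "a' k (j + 2) = a k (j + 2)" "b' k (j + 2) = b k (j + 2)" "a' k 1 = a k 1" "b' k 1 = b k 1"
    if "k \<in> {1..p}" for k j
    using polyharmonic_rep_unique[OF rep' rep that, of "j + 1"]
      polyharmonic_rep_unique[OF rep' rep that, of 0] by simp_all
  have b11: "b' 1 1 = b 1 1" using eq(4)[of 1] p by simp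
  have eq1: "(\<Sum>k=2..p. (2 * real k - 1) * (cmod (a' k 1) + cmod (b' k 1)))
      = (\<Sum>k=2..p. (2 * real k - 1) * (cmod (a k 1) + cmod (b k 1)))"
    by (intro sum.cong) (auto simp: eq(3,4)[unfolded One_nat_def])
  have eq2: "(\<Sum>k=1..p. \<Sum>j. (2 * (real k - 1) + real (j + 2) ^ 2) * (cmod (a' k (j + 2)) + cmod (b' k (j + 2))))
      = (\<Sum>k=1..p. \<Sum>j. (2 * (real k - 1) + real (j + 2) ^ 2) * (cmod (a k (j + 2)) + cmod (b k (j + 2))))"
    by (intro sum.cong refl suminf_cong) (simp only: eq(1,2))
  have "\<forall>k\<in>{1..p}. summable (\<lambda>j. (2 * (real k - 1) + real (j + 2) ^ 2) * (cmod (a k (j + 2)) + cmod (b k (j + 2))))"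
  proof
    fix k assume k: "k \<in> {1..p}"
    show "summable (\<lambda>j. (2 * (real k - 1) + real (j + 2) ^ 2) * (cmod (a k (j + 2)) + cmod (b k (j + 2))))"
      using HC k unfolding HC_condition_def eq(1,2)[OF k, symmetric] by blast
  qed
  then show ?thesis
    using HC b11 unfolding HC_condition_def eq1 eq2 by simp
qed

section \<open>Choice of the angles\<close>

lemma cis_minus_Arg_mult: "cis (- Arg v) * v = of_real (cmod v)"
proof -
  have "cis (- Arg v) * v = cis (- Arg v) * (of_real (cmod v) * cis (Arg v))"
    using rcis_cmod_Arg[of v] by (simp only: rcis_def)
  also have "\<dots> = of_real (cmod v) * (cis (- Arg v) * cis (Arg v))" by (simp only: mult.left_commute)
  finally show ?thesis by (simp add: cis_mult)
qed

text \<open>If \<open>v\<close> is nonzero, the hypothesis makes \<open>w\<close> a real multiple of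
  \<open>v\<close>, so the rotation that makes \<open>v\<close> real also makes \<open>w\<close>
  real.\<close>

lemma exists_real_rotation:
  fixes v w :: complex
  assumes "Im (w * cnj v) = 0"
  obtains \<alpha> where "Im (cis \<alpha> * v) = 0" "Im (cis \<alpha> * w) = 0"
proof (cases "v = 0")
  case True
  then show ?thesis using that[of "- Arg w"] by (simp only: cis_minus_Arg_mult) simp
next
  case False
  define c where "c = cis (- Arg v)"
  have cv: "c * v = of_real (cmod v)" unfolding c_def by (rule cis_minus_Arg_mult)
  have "c * w * of_real ((cmod v)\<^sup>2) = (c * v) * (w * cnj v)"
    unfolding complex_norm_square by (simp only: mult_ac)
  also have "\<dots> = of_real (cmod v) * (w * cnj v)" unfolding cv ..
  finally have eq: "c * w * of_real ((cmod v)\<^sup>2) = of_real (cmod v) * (w * cnj v)" .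
  have Im_right: "Im (x * of_real r) = Im x * r" and Im_left: "Im (of_real r * x) = r * Im x" for x r
    by simp_all
  have "Im (c * w) * (cmod v)\<^sup>2 = Im (of_real (cmod v) * (w * cnj v))"
    unfolding eq[symmetric] by (rule Im_right[symmetric])
  also have "\<dots> = 0" unfolding Im_left assms by simp
  finally have "Im (c * w) = 0" using False by simp
  moreover have "Im (c * v) = 0" unfolding cv by simp
  ultimately show ?thesis by (intro that[of "- Arg v"]) (simp_all only: c_def)
qed

lemma continuous_on_suminf_cis:
  fixes u :: "nat \<Rightarrow> complex"
  assumes "summable (\<lambda>n. cmod (u n))"
  shows "continuous_on UNIV (\<lambda>t. \<Sum>n. u n * cis t ^ Suc n)"
proof (rule uniform_limit_theorem[OF always_eventually[OF allI] _ sequentially_bot])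
  show "uniform_limit UNIV (\<lambda>n t. \<Sum>i<n. u i * cis t ^ Suc i) (\<lambda>t. \<Sum>n. u n * cis t ^ Suc n) sequentially"
    by (rule Weierstrass_m_test[OF _ assms]) (simp add: norm_mult norm_power)
qed (intro continuous_intros)

text \<open>With \<open>V t = X t - cnj (Y t)\<close>, the function \<open>Im (V (t + pi) * cnj (V t))\<close> changes sign when
  \<open>t\<close> increases by \<open>pi\<close>, so at some \<open>t = \<beta>\<close> the values of \<open>V\<close> at the antipodal points are
  real multiples of one complex number, which \<open>\<alpha>\<close> rotates to the real axis.\<close>

lemma exists_angles:
  fixes u v :: "nat \<Rightarrow> complex"
  defines "w \<equiv> \<lambda>\<alpha> \<beta> n. cis \<beta> ^ Suc n * (cis \<alpha> * u n + cis (- \<alpha>) * v n)"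
  assumes u: "summable (\<lambda>n. cmod (u n))" and v: "summable (\<lambda>n. cmod (v n))"
  obtains \<alpha> \<beta> where "Im (\<Sum>n. w \<alpha> \<beta> n) = 0" "0 \<le> Re (\<Sum>n. w \<alpha> \<beta> n)" "Im (\<Sum>n. (-1) ^ n * w \<alpha> \<beta> n) = 0"
proof -
  define X Y where "X = (\<lambda>t. \<Sum>n. u n * cis t ^ Suc n)" and "Y = (\<lambda>t. \<Sum>n. v n * cis t ^ Suc n)"
  define V where "V = (\<lambda>t. X t - cnj (Y t))"
  define G where "G = (\<lambda>t. Im (V (t + pi) * cnj (V t)))"
  have cis_pi: "cis (t + pi) = - cis t" for t by (simp add: cis_mult[symmetric])
  have cis_2pi: "cis (t + pi + pi) = cis t" for t by (simp only: cis_pi minus_minus)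
  have summ_cis: "summable (\<lambda>n. q n * cis t ^ Suc n)" if "summable (\<lambda>n. cmod (q n))" for q :: "nat \<Rightarrow> complex" and t
    by (rule summable_norm_cancel) (use that in \<open>simp add: norm_mult norm_power\<close>)
  have sums_u: "(\<lambda>n. u n * cis t ^ Suc n) sums X t" and sums_v: "(\<lambda>n. v n * cis t ^ Suc n) sums Y t" for t
    unfolding X_def Y_def using summ_cis[OF u] summ_cis[OF v] by (simp_all only: summable_sums)
  have contX: "continuous_on UNIV X" and contY: "continuous_on UNIV Y"
    unfolding X_def Y_def using continuous_on_suminf_cis u v by auto
  have contV: "continuous_on S (\<lambda>t. V (f t))" if "continuous_on S f" for S and f :: "real \<Rightarrow> real"
    unfolding V_def
    using continuous_on_compose2[OF contX that] continuous_on_compose2[OF contY that]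
    by (intro continuous_intros) auto
  have "continuous_on {0..pi} G"
    unfolding G_def by (intro continuous_intros contV)
  moreover have G_pi: "G pi = - G 0"
  proof -
    have V_pi: "V (pi + pi) = V 0" "V (0 + pi) = V pi"
      using cis_2pi[of 0] by (simp_all only: V_def X_def Y_def add_0)
    show ?thesis unfolding G_def V_pi by simp
  qed
  ultimately obtain \<beta> where "G \<beta> = 0"
    using IVT'[of G 0 0 pi] IVT2'[of G pi 0 0] by (cases "G 0 \<le> 0") (auto simp: pi_ge_zero)
  then obtain \<alpha>0 where \<alpha>0: "Im (cis \<alpha>0 * V \<beta>) = 0" "Im (cis \<alpha>0 * V (\<beta> + pi)) = 0"
    unfolding G_def by (rule exists_real_rotation)
  have sums_w: "w \<alpha> \<beta> sums (cis \<alpha> * X \<beta> + cis (- \<alpha>) * Y \<beta>)" for \<alpha>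
  proof -
    have "w \<alpha> \<beta> = (\<lambda>n. cis \<alpha> * (u n * cis \<beta> ^ Suc n) + cis (- \<alpha>) * (v n * cis \<beta> ^ Suc n))"
      by (simp add: w_def algebra_simps)
    then show ?thesis using sums_add[OF sums_mult[OF sums_u] sums_mult[OF sums_v]] by simp
  qed
  \<comment> \<open>The shift by \<open>pi\<close> produces \<open>(-1) ^ Suc n\<close>, hence the
    outer minus sign.\<close>
  have sums_w': "(\<lambda>n. (-1) ^ n * w \<alpha> \<beta> n) sums - (cis \<alpha> * X (\<beta> + pi) + cis (- \<alpha>) * Y (\<beta> + pi))" for \<alpha>
  proof -
    have "(\<lambda>n. (-1) ^ n * w \<alpha> \<beta> n) =
        (\<lambda>n. - (cis \<alpha> * (u n * cis (\<beta> + pi) ^ Suc n) + cis (- \<alpha>) * (v n * cis (\<beta> + pi) ^ Suc n)))"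
      unfolding cis_pi by (simp add: w_def power_minus[of "cis \<beta>"] algebra_simps)
    then show ?thesis using sums_minus[OF sums_add[OF sums_mult[OF sums_u] sums_mult[OF sums_v]]] by simp
  qed
  \<comment> \<open>\<open>cis (- \<alpha>) * Y t\<close> is the conjugate of
    \<open>cis \<alpha> * cnj (Y t)\<close>, so their imaginary parts are opposite; this is why
    \<open>V\<close> has the form \<open>X - cnj Y\<close>.\<close>
  have Im_eq: "Im (cis \<alpha> * X t + cis (- \<alpha>) * Y t) = Im (cis \<alpha> * V t)" for \<alpha> t
    by (simp add: V_def algebra_simps)
  \<comment> \<open>Adding \<open>pi\<close> negates both values, which keeps them real and corrects
    the sign of the first.\<close>
  define \<alpha> where "\<alpha> = (if 0 \<le> Re (cis \<alpha>0 * X \<beta> + cis (- \<alpha>0) * Y \<beta>) then \<alpha>0 else \<alpha>0 + pi)"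
  have neg: "cis (- (\<alpha>0 + pi)) = - cis (- \<alpha>0)"
    unfolding cis_cnj[symmetric] cis_pi by simp
  have "Im (cis \<alpha> * V \<beta>) = 0" "Im (cis \<alpha> * V (\<beta> + pi)) = 0"
    using \<alpha>0 by (auto simp: \<alpha>_def cis_pi)
  moreover have "0 \<le> Re (cis \<alpha> * X \<beta> + cis (- \<alpha>) * Y \<beta>)"
    unfolding \<alpha>_def using neg by (auto simp: cis_pi simp del: minus_add_distrib)
  ultimately show ?thesis
    by (intro that[of \<alpha> \<beta>])
      (simp_all only: sums_unique[OF sums_w, symmetric] sums_unique[OF sums_w', symmetric]
        Im_eq uminus_complex.sel minus_zero)
qed

section \<open>Positivity for the class \<open>HC\<close>\<close>

text \<open>Termwise differentiation. The value \<open>c 0\<close> is arbitrary, so \<open>d\<close>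
  replaces it by the true constant term 0.\<close>

lemma sums_deriv_polyharmonic_component:
  assumes "f holomorphic_on ball 0 1" and z: "z \<in> ball 0 1"
    and sums: "\<And>z. z \<in> ball 0 1 \<Longrightarrow> (\<lambda>j. c (Suc j) * z ^ Suc j) sums f z"
  shows "(\<lambda>n. of_nat (Suc n) * c (Suc n) * z ^ n) sums deriv f z"
proof -
  define d where "d = (\<lambda>n. if n = 0 then 0 else c n)"
  have "(\<lambda>n. d n * w ^ n) sums f w" if "cmod w < 1" for w
    using sums[of w] that sums_Suc_iff[of "\<lambda>n. d n * w ^ n"] by (simp add: d_def)
  moreover have "(f has_field_derivative deriv f z) (at z)"
    using assms by (intro holomorphic_derivI[of f "ball 0 1"]) auto
  ultimately have "(\<lambda>n. diffs d n * z ^ n) sums deriv f z"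
    using z by (intro termdiffs_sums_strong[where K = 1]) auto
  then show ?thesis by (simp add: diffs_def d_def)
qed

theorem theorem7:
  fixes p :: nat and F :: "complex \<Rightarrow> complex"
    and h g :: "nat \<Rightarrow> complex \<Rightarrow> complex" and a b :: "nat \<Rightarrow> nat \<Rightarrow> complex"
  assumes "p \<ge> 1"
    and "F \<in> polyharmonic_HC p"
    and "polyharmonic_rep p F h g a b"
    and "\<And>k. k \<in> {2..p} \<Longrightarrow> a k 1 = 0"
  shows "\<exists>\<alpha> \<beta> :: real. \<forall>z\<in>ball 0 1.
    Re ((cis \<alpha> * (\<Sum>k=1..p. complex_of_real (cmod z ^ (2 * (k - 1))) * deriv (h k) z)
         + cis (- \<alpha>) * (\<Sum>k=1..p. complex_of_real (cmod z ^ (2 * (k - 1))) * deriv (g k) z))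
        * (cis \<beta> - cis (- \<beta>) * z ^ 2)) > 0"
proof -
  note p = assms(1) and rep = assms(3)
  have HC: "HC_condition p a b"
    by (rule HC_condition_of_polyharmonic_HC[OF assms(2,3,1)])
  have a11: "a 1 1 = 1" using rep by (simp add: polyharmonic_rep_def)
  have one: "{1..p} = insert 1 {2..p}" using p by auto

  \<comment> \<open>The leading coefficient \<open>a 1 1 = 1\<close> is taken out; after rotation it
    becomes the unimodular \<open>m\<close>. The index is shifted to
    \<open>n = j - 1\<close>.\<close>
  define a0 where "a0 = (\<lambda>k n. if k = 1 \<and> n = 0 then 0 else a k (Suc n))"
  define b0 where "b0 = (\<lambda>k n. b k (Suc n))"
  define B where "B = (\<lambda>n. \<Sum>k=1..p. (real (Suc n) ^ 2 + 2 * real (k - 1)) * (cmod (a0 k n) + cmod (b0 k n)))"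
  \<comment> \<open>At \<open>n = 0\<close> the weight is
    \<open>1 + 2 * (k - 1) = 2 * k - 1\<close>. Hence the first inequality of the class becomes
    \<open>suminf B \<le> 1\<close> and the strict one \<open>B 0 < 1\<close>.\<close>
  have B0: "B 0 = cmod (b 1 1) + (\<Sum>k=2..p. (2 * real k - 1) * (cmod (a k 1) + cmod (b k 1)))"
    unfolding B_def one by (subst sum.insert) (auto simp: a0_def b0_def of_nat_diff intro!: sum.cong)
  have BS: "B (Suc n) = (\<Sum>k=1..p. (2 * (real k - 1) + real (n + 2) ^ 2) * (cmod (a k (n + 2)) + cmod (b k (n + 2))))" for n
    unfolding B_def by (intro sum.cong) (auto simp: a0_def b0_def of_nat_diff)
  have summ: "summable (\<lambda>j. (2 * (real k - 1) + real (j + 2) ^ 2) * (cmod (a k (j + 2)) + cmod (b k (j + 2))))"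
    if "k \<in> {1..p}" for k
    using HC that unfolding HC_condition_def by blast
  have "summable (\<lambda>n. B (Suc n))"
    unfolding BS by (rule summable_sum) (rule summ)
  then have summB: "summable B" by (simp only: summable_Suc_iff)
  have sumB: "suminf B \<le> 1" and B0_less: "B 0 < 1"
  proof -
    have "(\<Sum>n. B (Suc n)) = (\<Sum>k=1..p. \<Sum>j. (2 * (real k - 1) + real (j + 2) ^ 2) * (cmod (a k (j + 2)) + cmod (b k (j + 2))))"
      unfolding BS by (rule suminf_sum[OF summ])
    then show "suminf B \<le> 1"
      using suminf_split_head[OF summB] HC B0 unfolding HC_condition_def by linarith
    show "B 0 < 1" using HC B0 unfolding HC_condition_def by linarith
  qed

  \<comment> \<open>Taylor coefficients of the two derivative sums with all radial weights set to 1,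
    as needed for the choice of the angles.\<close>
  define u where "u = (\<lambda>n. of_nat (Suc n) * (\<Sum>k=1..p. a k (Suc n)))"
  define v where "v = (\<lambda>n. of_nat (Suc n) * (\<Sum>k=1..p. b k (Suc n)))"
  have coeff_le: "real (Suc n) * (\<Sum>k=1..p. cmod (a0 k n) + cmod (b0 k n)) \<le> B n" for n
    unfolding B_def sum_distrib_left
  proof (intro sum_mono mult_right_mono)
    fix k
    have "real (Suc n) \<le> (real (Suc n))\<^sup>2" by (simp add: power2_eq_square)
    then show "real (Suc n) \<le> (real (Suc n))\<^sup>2 + 2 * real (k - 1)" by simp
  qed simp
  have summu: "summable (\<lambda>n. cmod (u n))"
  \<comment> \<open>At \<open>n = 0\<close> the coefficient \<open>u 0\<close> still contains the
    leading 1, which \<open>B 0\<close> omits.\<close>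
  proof (rule summable_comparison_test'[OF summB, where N = 1])
    fix n :: nat assume "1 \<le> n"
    then have "cmod (u n) \<le> real (Suc n) * (\<Sum>k=1..p. cmod (a0 k n))"
      unfolding u_def norm_mult norm_of_nat a0_def by (intro mult_left_mono order_trans[OF norm_sum]) auto
    also have "\<dots> \<le> real (Suc n) * (\<Sum>k=1..p. cmod (a0 k n) + cmod (b0 k n))"
      by (intro mult_left_mono sum_mono) auto
    finally show "norm (cmod (u n)) \<le> B n" using coeff_le[of n] by simp
  qed
  have summv: "summable (\<lambda>n. cmod (v n))"
  proof (rule summable_comparison_test'[OF summB, where N = 0])
    fix n :: nat
    have "cmod (v n) \<le> real (Suc n) * (\<Sum>k=1..p. cmod (b0 k n))"
      unfolding v_def norm_mult norm_of_nat b0_def by (intro mult_left_mono norm_sum) auto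
    also have "\<dots> \<le> real (Suc n) * (\<Sum>k=1..p. cmod (a0 k n) + cmod (b0 k n))"
      by (intro mult_left_mono sum_mono) auto
    finally show "norm (cmod (v n)) \<le> B n" using coeff_le[of n] by simp
  qed
  define w where "w = (\<lambda>\<alpha> \<beta> n. cis \<beta> ^ Suc n * (cis \<alpha> * u n + cis (- \<alpha>) * v n))"
  obtain \<alpha> \<beta> where ang: "Im (\<Sum>n. w \<alpha> \<beta> n) = 0" "0 \<le> Re (\<Sum>n. w \<alpha> \<beta> n)"
      "Im (\<Sum>n. (-1) ^ n * w \<alpha> \<beta> n) = 0"
    using exists_angles[OF summu summv] unfolding w_def by blast

  define m where "m = cis \<beta> * cis \<alpha>"
  \<comment> \<open>Of the \<open>Suc n\<close> factors \<open>cis \<beta>\<close>, \<open>n\<close>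
    come from the rotated \<open>z ^ n\<close> and one from the second factor of the claim.\<close>
  define C where "C = (\<lambda>k n. cis \<beta> ^ Suc n * (cis \<alpha> * a0 k n + cis (- \<alpha>) * b0 k n))"
  define \<gamma> where "\<gamma> = (\<lambda>n. \<Sum>k=1..p. (real (Suc n) ^ 2 + 2 * real (k - 1)) * cmod (C k n))"
  define c where "c = (\<lambda>n. of_nat (Suc n) * (\<Sum>k=1..p. C k n))"
  have C_le: "cmod (C k n) \<le> cmod (a0 k n) + cmod (b0 k n)" for k n
    unfolding C_def norm_mult norm_power norm_cis power_one mult_1
    by (rule order_trans[OF norm_triangle_ineq]) (simp add: norm_mult)
  have \<gamma>_le: "\<gamma> n \<le> B n" for n
    unfolding \<gamma>_def B_def by (intro sum_mono mult_left_mono C_le) auto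
  have \<gamma>_nonneg: "0 \<le> \<gamma> n" for n unfolding \<gamma>_def by (intro sum_nonneg) auto
  have summ\<gamma>: "summable \<gamma>"
    by (rule summable_comparison_test'[OF summB, where N = 0]) (use \<gamma>_le \<gamma>_nonneg in auto)
  have C_eq: "cis \<beta> ^ Suc n * (cis \<alpha> * a k (Suc n) + cis (- \<alpha>) * b k (Suc n)) = C k n + (if k = 1 \<and> n = 0 then m else 0)" for k n
    using a11 by (auto simp: C_def a0_def b0_def m_def algebra_simps)
  \<comment> \<open>Stated for arbitrary weights: it serves with weight 1 at the points 1 and -1,
    and with the radial weights at \<open>z\<close>.\<close>
  have weighted: "(\<Sum>k=1..p. r k * (cis \<beta> ^ Suc n * (cis \<alpha> * a k (Suc n) + cis (- \<alpha>) * b k (Suc n))))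
      = (\<Sum>k=1..p. r k * C k n) + (if n = 0 then r 1 * m else 0)" for r :: "nat \<Rightarrow> complex" and n
  proof -
    have single: "(\<Sum>k=1..p. r k * (if k = 1 \<and> n = 0 then m else 0)) = (if n = 0 then r 1 * m else 0)"
      using p by (cases n) (auto simp: if_distrib[of "\<lambda>x. _ * x"] cong: if_cong)
    show ?thesis unfolding C_eq unfolding distrib_left sum.distrib single ..
  qed
  have w_c: "w \<alpha> \<beta> n = c n + (if n = 0 then m else 0)" for n
  proof -
    have "w \<alpha> \<beta> n = of_nat (Suc n) * (\<Sum>k=1..p. 1 * (cis \<beta> ^ Suc n * (cis \<alpha> * a k (Suc n) + cis (- \<alpha>) * b k (Suc n))))"
      by (simp add: w_def u_def v_def sum.distrib sum_distrib_left algebra_simps del: of_nat_Suc)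
    also have "\<dots> = c n + (if n = 0 then m else 0)"
      unfolding weighted c_def by (simp add: distrib_left)
    finally show ?thesis .
  qed
  have summc: "summable (\<lambda>n. s n * c n)" if "\<And>n. cmod (s n) = 1" for s
  proof (rule summable_comparison_test'[OF summB, where N = 0])
    fix n
    have "norm (s n * c n) \<le> real (Suc n) * (\<Sum>k=1..p. cmod (a0 k n) + cmod (b0 k n))"
      unfolding norm_mult that mult_1 c_def norm_of_nat
      by (intro mult_left_mono order_trans[OF norm_sum] sum_mono C_le) auto
    then show "norm (s n * c n) \<le> B n" using coeff_le[of n] by linarith
  qed
  have head: "(\<lambda>n. if n = 0 then m else 0) sums m"
    using sums_single[of 0 "\<lambda>_. m"] by simp
  have S: "(\<Sum>n. w \<alpha> \<beta> n) = m + (\<Sum>n. c n)"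
    using sums_unique[OF sums_add[OF summable_sums[OF summc[of "\<lambda>_. 1"]] head]]
    by (simp add: w_c add.commute)
  have S': "(\<Sum>n. (-1) ^ n * w \<alpha> \<beta> n) = m + (\<Sum>n. (-1) ^ n * c n)"
  proof -
    have "(\<lambda>n. (-1) ^ n * w \<alpha> \<beta> n) = (\<lambda>n. (-1) ^ n * c n + (if n = 0 then m else 0))"
      by (auto simp: w_c distrib_left)
    then show ?thesis
      using sums_unique[OF sums_add[OF summable_sums[OF summc[of "\<lambda>n. (-1) ^ n"]] head]]
      by (simp add: norm_power add.commute)
  qed

  have "0 < Re ((cis \<alpha> * (\<Sum>k=1..p. complex_of_real (cmod z ^ (2 * (k - 1))) * deriv (h k) z)
         + cis (- \<alpha>) * (\<Sum>k=1..p. complex_of_real (cmod z ^ (2 * (k - 1))) * deriv (g k) z))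
        * (cis \<beta> - cis (- \<beta>) * z ^ 2))" if z: "z \<in> ball 0 1" for z
  proof -
    \<comment> \<open>Turns \<open>cis \<beta> - cis (- \<beta>) * z^2\<close> into
      \<open>cis \<beta> * (1 - \<zeta>^2)\<close>.\<close>
    define \<zeta> where "\<zeta> = cis (- \<beta>) * z"
    have z_eq: "z = cis \<beta> * \<zeta>" by (simp add: \<zeta>_def mult.assoc[symmetric] cis_mult)
    have norm_\<zeta>: "cmod \<zeta> = cmod z" by (simp add: \<zeta>_def norm_mult)
    define r where "r = (\<lambda>k. complex_of_real (cmod z ^ (2 * (k - 1))))"
    define E where "E = cis \<alpha> * (\<Sum>k=1..p. r k * deriv (h k) z) + cis (- \<alpha>) * (\<Sum>k=1..p. r k * deriv (g k) z)"
    have sums_hg: "(\<lambda>n. of_nat (Suc n) * a k (Suc n) * z ^ n) sums deriv (h k) z"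
        "(\<lambda>n. of_nat (Suc n) * b k (Suc n) * z ^ n) sums deriv (g k) z" if k: "k \<in> {1..p}" for k
    proof -
      have hol: "h k holomorphic_on ball 0 1" "g k holomorphic_on ball 0 1"
        using rep k unfolding polyharmonic_rep_def by blast+
      have ser: "(\<lambda>j. a k (Suc j) * y ^ Suc j) sums h k y" "(\<lambda>j. b k (Suc j) * y ^ Suc j) sums g k y"
        if "y \<in> ball 0 1" for y
        using rep k that unfolding polyharmonic_rep_def by blast+
      show "(\<lambda>n. of_nat (Suc n) * a k (Suc n) * z ^ n) sums deriv (h k) z"
        by (rule sums_deriv_polyharmonic_component[OF hol(1) z ser(1)])
      show "(\<lambda>n. of_nat (Suc n) * b k (Suc n) * z ^ n) sums deriv (g k) z"
        by (rule sums_deriv_polyharmonic_component[OF hol(2) z ser(2)])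
    qed
    have "(\<lambda>n. cis \<beta> * (cis \<alpha> * (\<Sum>k=1..p. r k * (of_nat (Suc n) * a k (Suc n) * z ^ n))
        + cis (- \<alpha>) * (\<Sum>k=1..p. r k * (of_nat (Suc n) * b k (Suc n) * z ^ n)))) sums (cis \<beta> * E)"
      unfolding E_def by (intro sums_mult sums_add sums_sum sums_hg)
    also have "(\<lambda>n. cis \<beta> * (cis \<alpha> * (\<Sum>k=1..p. r k * (of_nat (Suc n) * a k (Suc n) * z ^ n))
        + cis (- \<alpha>) * (\<Sum>k=1..p. r k * (of_nat (Suc n) * b k (Suc n) * z ^ n))))
      = (\<lambda>n. of_nat (Suc n) * (\<Sum>k=1..p. r k * (cis \<beta> ^ Suc n * (cis \<alpha> * a k (Suc n) + cis (- \<alpha>) * b k (Suc n)))) * \<zeta> ^ n)"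
      by (rule ext) (simp add: z_eq power_mult_distrib sum_distrib_left sum_distrib_right sum.distrib[symmetric] algebra_simps del: of_nat_Suc)
    \<comment> \<open>The radial weight for \<open>k = 1\<close> is 1, so \<open>m\<close> appears
      unweighted.\<close>
    also have "\<dots> = (\<lambda>n. of_nat (Suc n) * (\<Sum>k=1..p. r k * C k n) * \<zeta> ^ n + (if n = 0 then m else 0))"
      unfolding weighted by (auto simp: r_def algebra_simps)
    finally have total: "(\<lambda>n. of_nat (Suc n) * (\<Sum>k=1..p. r k * C k n) * \<zeta> ^ n + (if n = 0 then m else 0)) sums (cis \<beta> * E)" .
    have "(\<lambda>n. of_nat (Suc n) * (\<Sum>k=1..p. r k * C k n) * \<zeta> ^ n) sums (cis \<beta> * E - m)"
      using sums_diff[OF total head] by (simp only: add_diff_cancel_right')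
    then have E_eq: "cis \<beta> * E = m + (\<Sum>n. of_nat (Suc n) * (\<Sum>k=1..p. r k * C k n) * \<zeta> ^ n)"
      by (simp only: sums_unique[symmetric] add_diff_eq add_diff_cancel_left')
    have "0 < Re ((m + (\<Sum>n. of_nat (Suc n) * (\<Sum>k=1..p. of_real (cmod \<zeta> ^ (2 * (k - 1))) * C k n) * \<zeta> ^ n))
                 * (1 - \<zeta>\<^sup>2))"
    proof (rule positivity_of_coefficients)
      show "cmod m = 1" by (simp add: m_def norm_mult)
      show "summable (\<lambda>n. \<Sum>k=1..p. (real (Suc n) ^ 2 + 2 * real (k - 1)) * cmod (C k n))"
        using summ\<gamma> unfolding \<gamma>_def .
      show "(\<Sum>n. \<Sum>k=1..p. (real (Suc n) ^ 2 + 2 * real (k - 1)) * cmod (C k n)) \<le> 1"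
        using suminf_le[OF \<gamma>_le summ\<gamma> summB] sumB unfolding \<gamma>_def by linarith
      show "(\<Sum>k=1..p. (real (Suc 0) ^ 2 + 2 * real (k - 1)) * cmod (C k 0)) < 1"
        using \<gamma>_le[of 0] B0_less unfolding \<gamma>_def by linarith
      show "Im (m + (\<Sum>n. of_nat (Suc n) * (\<Sum>k=1..p. C k n))) = 0"
        "0 \<le> Re (m + (\<Sum>n. of_nat (Suc n) * (\<Sum>k=1..p. C k n)))"
        using ang(1,2) unfolding S c_def .
      show "Im (m + (\<Sum>n. (- 1) ^ n * (of_nat (Suc n) * (\<Sum>k=1..p. C k n)))) = 0"
        using ang(3) unfolding S' c_def .
      show "cmod \<zeta> < 1" using z norm_\<zeta> by simp
    qed
    also have "(m + (\<Sum>n. of_nat (Suc n) * (\<Sum>k=1..p. of_real (cmod \<zeta> ^ (2 * (k - 1))) * C k n) * \<zeta> ^ n)) * (1 - \<zeta>\<^sup>2)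
        = cis \<beta> * E * (1 - \<zeta>\<^sup>2)"
      unfolding E_eq r_def norm_\<zeta> ..
    also have "\<dots> = E * (cis \<beta> - cis (- \<beta>) * z ^ 2)"
    proof -
      have "cis \<beta> * \<zeta>\<^sup>2 = cis (- \<beta>) * z\<^sup>2"
        by (simp add: \<zeta>_def power2_eq_square mult.assoc[symmetric] cis_mult)
      then show ?thesis by (simp add: algebra_simps)
    qed
    finally show ?thesis unfolding E_def r_def .
  qed
  then show ?thesis by blast
qed

end
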